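(* In an interactive temporal assumption model $\mathcal{W}$, if $\Box(A^{ab}\mathbf{U}^b)$ is satisfiable, then $$\Box\big[B^{ab}A^{ba}(\bigcirc\Box \mathbf{D})\big] \longrightarrow \Box\mathbf{D}$$ is valid in $\mathcal{W}$.
   Context: A belief model is a two-sorted structure $(U^a,U^b,P^a,P^b)$ with nonempty $U^a,U^b$, $P^a$ a proper subset of $U^a\times U^b$, $P^b$ a proper subset of $U^b\times U^a$, both serial. An interactive temporal assumption model (iTAL-model) is a Kripke structure $\mathcal{W}=(W,\mathbb{N},\{P_n:n\in\mathbb{N}\},U^a,U^b,V)$ where $W$ is a nonempty set, each $P_n\subseteq W\times W$, $U^a,U^b$ are disjoint with $U^a\cup U^b=W$, and for each $n$, $(U^a,U^b,P_n^a,P_n^b)$ is a belief model with $P_n^a=P_n\cap(U^a\times U^b)$, $P_n^b=P_n\cap(U^b\times U^a)$; $V$ maps each propositional letter to a subset of $\mathbb{N}\times W$. Formulas are built from propositional letters with $\neg,\wedge$, the temporal operators $\bigcirc$ ("next") and $\Box$ ("always"), and epistemic operators $B^{ij}$ (belief of player $i$ about $j$) and $A^{ij}$ (assumption of $i$ about $j$), $i,j\in\{a,b\}$. Satisfaction at a moment $n$ and world $w$: $(n,w)\Vdash p$ iff $(n,w)\in V(p)$; usual clauses for $\neg,\wedge$; $(n,w)\Vdash\bigcirc\varphi$ iff $(n+1,w)\Vdash\varphi$; $(n,w)\Vdash\Box\varphi$ iff $(m,w)\Vdash\varphi$ for all $m\ge n$; $(n,w)\Vdash B^{ij}\varphi$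 iff $(n,w)\Vdash\mathbf{U}^i$ and for all $z$, $(P_n(w,z)\wedge (n,z)\Vdash\mathbf{U}^j)\to (n,z)\Vdash\varphi$; $(n,w)\Vdash A^{ij}\varphi$ iff $(n,w)\Vdash\mathbf{U}^i$ and for all $z$, $(P_n(w,z)\wedge (n,z)\Vdash\mathbf{U}^j)\leftrightarrow (n,z)\Vdash\varphi$. Here $\mathbf{U}^a,\mathbf{U}^b$ are propositions true at worlds of $U^a$, resp. $U^b$. $\mathbf{D}$ is a propositional symbol with $V(\mathbf{D})=\{(n,x): \forall y\in W\,[P_n(x,y)\to\neg P_n(y,x)]\}$ (formal counterpart of "Ann believes that Bob's assumption is wrong"). A formula is valid in $\mathcal{W}$ if true at all states, satisfiable if true at some state.
   Formalization: The possibility relation is additionally assumed two-sorted, P_n = P_n^a ∪ P_n^b (no arrows inside U^a or inside U^b); without this the claim is false, since D sees all P_n-arrows while B^{ab} and A^{ba} see only those between the two sides. *)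

theory Defs
  imports Main
begin

datatype player = Ann | Bob

text \<open>
  The propositional letters contain three distinguished symbols: \<open>U\<^sup>a\<close>, \<open>U\<^sup>b\<close>
  (here \<open>PlayerL Ann\<close>, \<open>PlayerL Bob\<close>) and \<open>\<^bold>D\<close> (here \<open>DiagL\<close>), whose valuation is prescribed
  in every model; the letters \<open>Atom p\<close> are interpreted arbitrarily.
\<close>

datatype 'p letter = PlayerL player | DiagL | Atom 'p

datatype 'p form =
    Letter "'p letter"
  | Neg "'p form"
  | Conj "'p form" "'p form"
  | Next "'p form"
  | Always "'p form"
  | Bel player player "'p form"
  | Asm player player "'p form"

definition Imp :: "'p form \<Rightarrow> 'p form \<Rightarrow> 'p form" where
  "Imp \<phi> \<psi> = Neg (Conj \<phi> (Neg \<psi>))"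

abbreviation UProp :: "player \<Rightarrow> 'p form" where
  "UProp i \<equiv> Letter (PlayerL i)"

abbreviation DProp :: "'p form" where
  "DProp \<equiv> Letter DiagL"

definition serial_between :: "'w set \<Rightarrow> 'w set \<Rightarrow> ('w \<times> 'w) set \<Rightarrow> bool" where
  "serial_between A B R \<longleftrightarrow> (\<forall>x\<in>A. \<exists>y\<in>B. (x, y) \<in> R)"

definition belief_model ::
  "'w set \<Rightarrow> 'w set \<Rightarrow> ('w \<times> 'w) set \<Rightarrow> ('w \<times> 'w) set \<Rightarrow> bool" where
  "belief_model Ua Ub Pa Pb \<longleftrightarrow>
     Ua \<noteq> {} \<and> Ub \<noteq> {} \<and>
     Pa \<subset> Ua \<times> Ub \<and> Pb \<subset> Ub \<times> Ua \<and>
     serial_between Ua Ub Pa \<and> serial_between Ub Ua Pb"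

record ('w, 'p) itam =
  worlds :: "'w set"
  poss :: "nat \<Rightarrow> ('w \<times> 'w) set"
  side :: "player \<Rightarrow> 'w set"
  val :: "'p letter \<Rightarrow> (nat \<times> 'w) set"

text \<open>
  The possibility relation is two-sorted, \<open>P\<^sub>n = P\<^sub>n\<^sup>a \<union> P\<^sub>n\<^sup>b\<close>: a player only considers states of
  the other player. This is what the third clause on \<open>poss\<close> says. It is not redundant, because
  \<open>\<^bold>D\<close> quantifies over all \<open>P\<^sub>n\<close>-successors whereas belief and assumption of one player about the
  other only see the arrows between the two sides. Let \<open>U\<^sup>a = {w,u,x}\<close>, \<open>U\<^sup>b = {z,v}\<close> and, at all
  times, let the arrows be \<open>wz, uv, xz, xv, zu, vx\<close> and in addition \<open>ww, zz\<close>. Then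
  \<open>\<box>A\<^sup>a\<^sup>b U\<^sup>b\<close> holds at \<open>x\<close> and \<open>\<box>B\<^sup>a\<^sup>b A\<^sup>b\<^sup>a (\<circle>\<box>\<^bold>D)\<close> holds at \<open>w\<close>, but \<open>\<^bold>D\<close> fails at \<open>w\<close>.
\<close>

definition itam_model :: "('w, 'p) itam \<Rightarrow> bool" where
  "itam_model M \<longleftrightarrow>
     worlds M \<noteq> {} \<and>
     side M Ann \<inter> side M Bob = {} \<and>
     side M Ann \<union> side M Bob = worlds M \<and>
     (\<forall>n. poss M n \<subseteq> worlds M \<times> worlds M) \<and>
     (\<forall>n. belief_model (side M Ann) (side M Bob)
            (poss M n \<inter> side M Ann \<times> side M Bob)
            (poss M n \<inter> side M Bob \<times> side M Ann)) \<and>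
     (\<forall>n. poss M n = (poss M n \<inter> side M Ann \<times> side M Bob) \<union>
                      (poss M n \<inter> side M Bob \<times> side M Ann)) \<and>
     (\<forall>l. val M l \<subseteq> UNIV \<times> worlds M) \<and>
     (\<forall>i. val M (PlayerL i) = UNIV \<times> side M i) \<and>
     val M DiagL =
       {(n, x). x \<in> worlds M \<and> (\<forall>y\<in>worlds M. (x, y) \<in> poss M n \<longrightarrow> (y, x) \<notin> poss M n)}"

primrec sat :: "('w, 'p) itam \<Rightarrow> nat \<Rightarrow> 'w \<Rightarrow> 'p form \<Rightarrow> bool" where
  "sat M n w (Letter l) \<longleftrightarrow> (n, w) \<in> val M l"
| "sat M n w (Neg \<phi>) \<longleftrightarrow> \<not> sat M n w \<phi>"
| "sat M n w (Conj \<phi> \<psi>) \<longleftrightarrow> sat M n w \<phi> \<and> sat M n w \<psi>"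
| "sat M n w (Next \<phi>) \<longleftrightarrow> sat M (n + 1) w \<phi>"
| "sat M n w (Always \<phi>) \<longleftrightarrow> (\<forall>m\<ge>n. sat M m w \<phi>)"
| "sat M n w (Bel i j \<phi>) \<longleftrightarrow>
     (n, w) \<in> val M (PlayerL i) \<and>
     (\<forall>z\<in>worlds M. ((w, z) \<in> poss M n \<and> (n, z) \<in> val M (PlayerL j)) \<longrightarrow> sat M n z \<phi>)"
| "sat M n w (Asm i j \<phi>) \<longleftrightarrow>
     (n, w) \<in> val M (PlayerL i) \<and>
     (\<forall>z\<in>worlds M. ((w, z) \<in> poss M n \<and> (n, z) \<in> val M (PlayerL j)) \<longleftrightarrow> sat M n z \<phi>)"

definition valid_in :: "('w, 'p) itam \<Rightarrow> 'p form \<Rightarrow> bool" where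
  "valid_in M \<phi> \<longleftrightarrow> (\<forall>n. \<forall>w\<in>worlds M. sat M n w \<phi>)"

definition satisfiable_in :: "('w, 'p) itam \<Rightarrow> 'p form \<Rightarrow> bool" where
  "satisfiable_in M \<phi> \<longleftrightarrow> (\<exists>n. \<exists>w\<in>worlds M. sat M n w \<phi>)"

end

theory Submission
  imports Defs
begin

text \<open>
  Suppose \<open>\<^bold>D\<close> fails at \<open>(m, w)\<close>, witnessed by \<open>z\<close> with arrows \<open>wz\<close> and \<open>zw\<close>. As \<open>z\<close> assumes
  \<open>\<circle>\<box>\<^bold>D\<close>, the arrow \<open>zw\<close> gives \<open>\<^bold>D\<close> at \<open>w\<close> at all times after \<open>m\<close>. At time \<open>m + 1\<close> seriality
  yields an arrow from \<open>w\<close> to some \<open>z'\<close>, which again assumes \<open>\<circle>\<box>\<^bold>D\<close>; since \<open>\<circle>\<box>\<^bold>D\<close> persists at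
  \<open>w\<close>, the state \<open>z'\<close> has an arrow back to \<open>w\<close>, contradicting \<open>\<^bold>D\<close> at \<open>(m + 1, w)\<close>.
\<close>

lemma sat_Imp [simp]: "sat M n w (Imp \<phi> \<psi>) \<longleftrightarrow> (sat M n w \<phi> \<longrightarrow> sat M n w \<psi>)"
  by (simp add: Imp_def)

lemma itam_poss_worlds:
  assumes "itam_model M" "(x, y) \<in> poss M n"
  shows "x \<in> worlds M" "y \<in> worlds M"
  using assms unfolding itam_model_def by blast+

text \<open>Two-sortedness of \<open>poss\<close> enters here: \<open>Bel Ann Bob\<close> constrains
  only successors on Bob's side.\<close>

lemma itam_poss_Ann_Bob:
  assumes "itam_model M" "x \<in> side M Ann" "(x, y) \<in> poss M n"
  shows "y \<in> side M Bob"
  using assms unfolding itam_model_def by blast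

lemma itam_serial_Ann:
  assumes "itam_model M" "x \<in> side M Ann"
  obtains y where "y \<in> side M Bob" "(x, y) \<in> poss M n"
proof -
  have "belief_model (side M Ann) (side M Bob)
      (poss M n \<inter> side M Ann \<times> side M Bob) (poss M n \<inter> side M Bob \<times> side M Ann)"
    using assms(1) by (simp only: itam_model_def)
  then have "serial_between (side M Ann) (side M Bob) (poss M n \<inter> side M Ann \<times> side M Bob)"
    unfolding belief_model_def by (elim conjE)
  then show ?thesis
    using assms(2) that unfolding serial_between_def by blast
qed

lemma sat_UProp:
  assumes "itam_model M"
  shows "sat M n w (UProp i) \<longleftrightarrow> w \<in> side M i"
proof -
  have "val M (PlayerL i) = UNIV \<times> side M i"
    using assms unfolding itam_model_def by blast
  then show ?thesis by simp
qed

lemma sat_DProp: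
  assumes "itam_model M"
  shows "sat M n w DProp \<longleftrightarrow>
    w \<in> worlds M \<and> (\<forall>y\<in>worlds M. (w, y) \<in> poss M n \<longrightarrow> (y, w) \<notin> poss M n)"
proof -
  have "val M DiagL =
      {(n, x). x \<in> worlds M \<and> (\<forall>y\<in>worlds M. (x, y) \<in> poss M n \<longrightarrow> (y, x) \<notin> poss M n)}"
    using assms unfolding itam_model_def by (elim conjE)
  then show ?thesis by simp
qed

lemma Bel_Ann_D:
  assumes "itam_model M" "sat M n w (Bel Ann Bob \<phi>)"
  shows "w \<in> side M Ann" "\<And>z. (w, z) \<in> poss M n \<Longrightarrow> sat M n z \<phi>"
proof -
  show w: "w \<in> side M Ann"
    using assms(2) sat_UProp[OF assms(1), of n w Ann] unfolding sat.simps by blast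
  fix z assume z: "(w, z) \<in> poss M n"
  show "sat M n z \<phi>"
    using assms(2) z itam_poss_worlds(2)[OF assms(1) z]
      itam_poss_Ann_Bob[OF assms(1) w z] sat_UProp[OF assms(1), of n z Bob]
    unfolding sat.simps by blast
qed

text \<open>Assumption, unlike belief, is a biconditional. The main proof uses it from left to right
  at time \<open>m\<close> and from right to left at \<open>Suc m\<close>.\<close>

lemma Asm_Bob_poss_iff:
  assumes "itam_model M" "sat M n z (Asm Bob Ann \<phi>)" "w \<in> side M Ann"
  shows "(z, w) \<in> poss M n \<longleftrightarrow> sat M n w \<phi>"
proof -
  have "w \<in> worlds M"
    using assms(1,3) unfolding itam_model_def by blast
  then show ?thesis
    using assms(2,3) sat_UProp[OF assms(1), of n w Ann] unfolding sat.simps by blast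
qed

theorem theorem1:
  fixes M :: "('w, 'p) itam"
  assumes "itam_model M"
    and "satisfiable_in M (Always (Asm Ann Bob (UProp Bob)))"
  shows "valid_in M (Imp (Always (Bel Ann Bob (Asm Bob Ann (Next (Always DProp)))))
                         (Always DProp))"
proof -
  let ?\<delta> = "Next (Always DProp) :: 'p form"
  note M = assms(1)
  have "sat M m w DProp"
    if w: "w \<in> worlds M" and bel: "sat M n w (Always (Bel Ann Bob (Asm Bob Ann ?\<delta>)))"
      and "n \<le> m" for n m w
  proof (rule ccontr)
    assume "\<not> sat M m w DProp"
    then obtain z where wz: "(w, z) \<in> poss M m" and zw: "(z, w) \<in> poss M m"
      using w unfolding sat_DProp[OF M] by blast
    have bel_m: "sat M m w (Bel Ann Bob (Asm Bob Ann ?\<delta>))"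
      and bel_Suc: "sat M (Suc m) w (Bel Ann Bob (Asm Bob Ann ?\<delta>))"
      using bel \<open>n \<le> m\<close> by (simp_all only: sat.simps(5) le_SucI)
    have Ann: "w \<in> side M Ann"
      using Bel_Ann_D(1)[OF M bel_m] .
    have "sat M m w ?\<delta>"
      using Asm_Bob_poss_iff[OF M Bel_Ann_D(2)[OF M bel_m wz] Ann] zw by simp
    \<comment> \<open>\<open>?\<delta>\<close> at \<open>m\<close> means \<open>DProp\<close> at all
      times from \<open>Suc m\<close> on, hence also from \<open>Suc (Suc m)\<close> on.\<close>
    then have D: "sat M (Suc m) w DProp" and \<delta>: "sat M (Suc m) w ?\<delta>"
      by simp_all
    \<comment> \<open>Arrows may change with time, so \<open>z'\<close> need not be
      \<open>z\<close>; only \<open>w\<close> is kept.\<close>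
    obtain z' where wz': "(w, z') \<in> poss M (Suc m)"
      using itam_serial_Ann[OF M Ann] .
    have "(z', w) \<in> poss M (Suc m)"
      using Asm_Bob_poss_iff[OF M Bel_Ann_D(2)[OF M bel_Suc wz'] Ann] \<delta> by simp
    then show False
      using D wz' itam_poss_worlds(2)[OF M wz'] unfolding sat_DProp[OF M] by blast
  qed
  then show ?thesis
    unfolding valid_in_def sat_Imp sat.simps(5) by blast
qed

end
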